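(* Suppose that $\mathbf Q$ is diagonal with diagonal elements $q_i>0$, that $\widetilde{\boldsymbol\beta}_{\mathbf l}=\mathbf H_{\mathbf l}'\widetilde{\boldsymbol\beta}$ for every model $M_{\mathbf l}$ under consideration, and that the models under consideration are nested, i.e. they are $M_{\mathbf l(j)}$, $j=0,\dots,k$, where $\mathbf l(j)=(1,\dots,1,0,\dots,0)$ has $j$ ones followed by $k-j$ zeroes. Then the best predictive model is the median probability model, given either by $M_{\mathbf l^*}$ with $l_i^*=1$ if $p_i\ge\frac12$ and $l_i^*=0$ otherwise, or by $M_{\mathbf l(j^* )}$ with $j^*$ such that $$\sum_{i=0}^{j^*-1}P(M_{\mathbf l(i)}|\mathbf y)<\tfrac12\quad\text{and}\quad\sum_{i=0}^{j^*}P(M_{\mathbf l(i)}|\mathbf y)\ge\tfrac12 .$$ (That is, the model given by either description minimizes $R$ over the models under consideration.)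
   Context: Full model: $\mathbf y=\mathbf X\boldsymbol\beta+\boldsymbol\varepsilon$, with $\mathbf y\in\mathbb R^n$ observed, $\mathbf X$ an $n\times k$ ($k<n$) design matrix of full rank, $\boldsymbol\beta\in\mathbb R^k$ unknown, and $\boldsymbol\varepsilon$ having independent $N(0,\sigma^2)$ coordinates ($\sigma^2$ known or unknown). For an index $\mathbf l=(l_1,\dots,l_k)\in\{0,1\}^k$, the submodel is $M_{\mathbf l}:\ \mathbf y=\mathbf X_{\mathbf l}\boldsymbol\beta_{\mathbf l}+\boldsymbol\varepsilon$, where $\mathbf X_{\mathbf l}$ consists of the columns $i$ of $\mathbf X$ with $l_i=1$; $k_{\mathbf l}=\sum_i l_i$. All sums over $\mathbf l$ are over the models under consideration. Posterior inputs: for each model under consideration a posterior probability $p_{\mathbf l}=P(M_{\mathbf l}|\mathbf y)\ge 0$, with $\sum_{\mathbf l}p_{\mathbf l}=1$, and a posterior distribution $\pi_{\mathbf l}(\boldsymbol\beta_{\mathbf l},\sigma|\mathbf y)$, with posterior mean $\widetilde{\boldsymbol\beta}_{\mathbf l}\in\mathbb R^{k_{\mathbf l}}$ of $\boldsymbol\beta_{\mathbf l}$. (These inputs need not arise from a single coherent prior.) $\widetilde{\boldsymbol\beta}$ denotes the posterior mean of $\boldsymbol\beta$ in the full model $\mathbf l=(1,\dots,1)$. $\mathbf H_{\mathbf l}$ is the $k\times k_{\mathbf l}$ matrix whose $(i,j)$ entry is $1$ if $l_i=1$ and $j=\sum_{r=1}^i l_r$, and $0$ otherwise; for $\mathbf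 l=\mathbf 0$, $\mathbf H_{\mathbf l}\widetilde{\boldsymbol\beta}_{\mathbf l}$ is the zero vector. Set $\bar{\boldsymbol\beta}=\sum_{\mathbf l}p_{\mathbf l}\mathbf H_{\mathbf l}\widetilde{\boldsymbol\beta}_{\mathbf l}$. Prediction: a future $y^*=\mathbf x^*\boldsymbol\beta+\varepsilon$ is predicted under squared error loss, by $\widehat y^*_{\mathbf l}=\mathbf x^*\mathbf H_{\mathbf l}\widetilde{\boldsymbol\beta}_{\mathbf l}$ if $M_{\mathbf l}$ is used; the random row vector $\mathbf x^*$ of future covariates has $\mathbf Q=\mathbf E[(\mathbf x^* )'(\mathbf x^* )]$ existing and positive definite. Define $$R(M_{\mathbf l})=(\mathbf H_{\mathbf l}\widetilde{\boldsymbol\beta}_{\mathbf l}-\bar{\boldsymbol\beta})'\mathbf Q(\mathbf H_{\mathbf l}\widetilde{\boldsymbol\beta}_{\mathbf l}-\bar{\boldsymbol\beta}).$$ The best predictive model is the model under consideration minimizing $R(M_{\mathbf l})$ (equivalently, minimizing the posterior expected predictive squared error loss, which differs from $R(M_{\mathbf l})$ by a constant not depending on $\mathbf l$). The posterior inclusion probability of variable $i$ is $p_i=\sum_{\mathbf l:\,l_i=1}p_{\mathbf l}$. The two descriptions of the median probability model can differ only when some partial sum of the posterior model probabilities equals exactly $\frac12$. *)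

theory Defs
  imports "HOL-Probability.Probability" "Jordan_Normal_Form.DL_Rank"
begin

text \<open>Vectors and matrices are those of Jordan_Normal_Form, with indices starting at 0; the
  notation of HOL-Analysis for its own vectors is switched off.\<close>

unbundle no vec_syntax
unbundle no inner_syntax
hide_const (open) Finite_Cartesian_Product.vec Finite_Cartesian_Product.mat
hide_type (open) Finite_Cartesian_Product.vec

definition normal_linear_model ::
  "'s measure \<Rightarrow> nat \<Rightarrow> nat \<Rightarrow> real mat \<Rightarrow> real vec \<Rightarrow> real \<Rightarrow> (nat \<Rightarrow> 's \<Rightarrow> real) \<Rightarrow> ('s \<Rightarrow> real vec) \<Rightarrow> bool"
where
  "normal_linear_model S n k X \<beta> \<sigma> \<epsilon> Y \<longleftrightarrow>
     k < n \<and> X \<in> carrier_mat n k \<and> vec_space.rank n X = k \<and> \<beta> \<in> carrier_vec k \<and> 0 < \<sigma> \<and>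
     prob_space S \<and>
     prob_space.indep_vars S (\<lambda>_. borel) \<epsilon> {..<n} \<and>
     (\<forall>i<n. distributed S lborel (\<epsilon> i) (normal_density 0 \<sigma>)) \<and>
     (\<forall>\<omega>\<in>space S. Y \<omega> = X *\<^sub>v \<beta> + vec n (\<lambda>i. \<epsilon> i \<omega>))"

definition model_indices :: "nat \<Rightarrow> nat vec set" where
  "model_indices k = {l \<in> carrier_vec k. \<forall>i<k. l $ i \<in> {0, 1}}"

definition model_size :: "nat vec \<Rightarrow> nat" where
  "model_size l = (\<Sum>i<dim_vec l. l $ i)"

definition full_model :: "nat \<Rightarrow> nat vec" where
  "full_model k = vec k (\<lambda>_. 1)"

definition nested_model :: "nat \<Rightarrow> nat \<Rightarrow> nat vec" where
  "nested_model k j = vec k (\<lambda>i. if i < j then 1 else 0)"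

text \<open>With rows and columns counted from 0, the condition on the column index of an entry 1
  becomes \<open>j + 1 = l\<^sub>0 + \<dots> + l\<^sub>i\<close>.\<close>

definition H_mat :: "nat vec \<Rightarrow> real mat" where
  "H_mat l = mat (dim_vec l) (model_size l)
     (\<lambda>(i, j). if l $ i = 1 \<and> j + 1 = (\<Sum>r\<le>i. l $ r) then 1 else 0)"

text \<open>The space of pairs \<open>(\<beta>\<^sub>l, \<sigma>)\<close> with \<open>d\<close> regression coefficients. A known \<open>\<sigma>\<close> corresponds to
  distributions whose second marginal is a point mass.\<close>

definition param_space :: "nat \<Rightarrow> ((nat \<Rightarrow> real) \<times> real) measure" where
  "param_space d = (\<Pi>\<^sub>M i\<in>{..<d}. borel) \<Otimes>\<^sub>M restrict_space borel {0<..}"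

text \<open>No relation between the posterior distributions of different models, or between them and
  the posterior model probabilities, is required. The last clause makes the posterior means exist.\<close>

definition posterior_inputs ::
  "nat \<Rightarrow> nat vec set \<Rightarrow> (nat vec \<Rightarrow> real) \<Rightarrow> (nat vec \<Rightarrow> ((nat \<Rightarrow> real) \<times> real) measure) \<Rightarrow> bool"
where
  "posterior_inputs k models p \<pi> \<longleftrightarrow>
     models \<subseteq> model_indices k \<and>
     (\<forall>l\<in>models. 0 \<le> p l) \<and> (\<Sum>l\<in>models. p l) = 1 \<and>
     (\<forall>l\<in>models. prob_space (\<pi> l) \<and> sets (\<pi> l) = sets (param_space (model_size l)) \<and>
        (\<forall>j<model_size l. integrable (\<pi> l) (\<lambda>(b, s). b j)))"

definition posterior_mean ::
  "(nat vec \<Rightarrow> ((nat \<Rightarrow> real) \<times> real) measure) \<Rightarrow> nat vec \<Rightarrow> real vec" where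
  "posterior_mean \<pi> l = vec (model_size l) (\<lambda>j. \<integral>(b, s). b j \<partial>\<pi> l)"

definition averaged_coeffs ::
  "nat \<Rightarrow> nat vec set \<Rightarrow> (nat vec \<Rightarrow> real) \<Rightarrow> (nat vec \<Rightarrow> real vec) \<Rightarrow> real vec" where
  "averaged_coeffs k models p b = vec k (\<lambda>i. \<Sum>l\<in>models. p l * (H_mat l *\<^sub>v b l) $ i)"

text \<open>The future covariates form a random row vector, that is, a random matrix with one row.\<close>

definition future_covariates :: "'w measure \<Rightarrow> nat \<Rightarrow> ('w \<Rightarrow> real mat) \<Rightarrow> bool" where
  "future_covariates M k x \<longleftrightarrow>
     prob_space M \<and> (\<forall>\<omega>\<in>space M. x \<omega> \<in> carrier_mat 1 k) \<and>
     (\<forall>i<k. (\<lambda>\<omega>. x \<omega> $$ (0, i)) \<in> borel_measurable M) \<and>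
     (\<forall>i<k. \<forall>j<k. integrable M (\<lambda>\<omega>. (transpose_mat (x \<omega>) * x \<omega>) $$ (i, j)))"

definition second_moment_mat :: "'w measure \<Rightarrow> nat \<Rightarrow> ('w \<Rightarrow> real mat) \<Rightarrow> real mat" where
  "second_moment_mat M k x =
     mat k k (\<lambda>(i, j). \<integral>\<omega>. (transpose_mat (x \<omega>) * x \<omega>) $$ (i, j) \<partial>M)"

definition positive_definite :: "nat \<Rightarrow> real mat \<Rightarrow> bool" where
  "positive_definite k Q \<longleftrightarrow>
     Q \<in> carrier_mat k k \<and> transpose_mat Q = Q \<and>
     (\<forall>v\<in>carrier_vec k. v \<noteq> 0\<^sub>v k \<longrightarrow> 0 < v \<bullet> (Q *\<^sub>v v))"

definition predictive_risk ::
  "nat \<Rightarrow> real mat \<Rightarrow> nat vec set \<Rightarrow> (nat vec \<Rightarrow> real) \<Rightarrow> (nat vec \<Rightarrow> real vec) \<Rightarrow> nat vec \<Rightarrow> real"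
where
  "predictive_risk k Q models p b l =
     (let d = H_mat l *\<^sub>v b l - averaged_coeffs k models p b in d \<bullet> (Q *\<^sub>v d))"

definition best_predictive_model ::
  "nat \<Rightarrow> real mat \<Rightarrow> nat vec set \<Rightarrow> (nat vec \<Rightarrow> real) \<Rightarrow> (nat vec \<Rightarrow> real vec) \<Rightarrow> nat vec \<Rightarrow> bool"
where
  "best_predictive_model k Q models p b l \<longleftrightarrow>
     is_arg_min (predictive_risk k Q models p b) (\<lambda>l'. l' \<in> models) l"

definition inclusion_prob :: "nat vec set \<Rightarrow> (nat vec \<Rightarrow> real) \<Rightarrow> nat \<Rightarrow> real" where
  "inclusion_prob models p i = (\<Sum>l\<in>{l \<in> models. l $ i = 1}. p l)"

definition median_model :: "nat \<Rightarrow> nat vec set \<Rightarrow> (nat vec \<Rightarrow> real) \<Rightarrow> nat vec" where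
  "median_model k models p = vec k (\<lambda>i. if 1 / 2 \<le> inclusion_prob models p i then 1 else 0)"

definition nested_median_size :: "nat \<Rightarrow> (nat vec \<Rightarrow> real) \<Rightarrow> nat \<Rightarrow> bool" where
  "nested_median_size k p j \<longleftrightarrow>
     j \<le> k \<and> (\<Sum>i<j. p (nested_model k i)) < 1 / 2 \<and> 1 / 2 \<le> (\<Sum>i\<le>j. p (nested_model k i))"

end

theory Submission
  imports Defs
begin

text \<open>Under the hypothesis on the posterior means, passing to a submodel simply overwrites some
  coordinates of the full posterior mean \<open>v\<close> with zero, so \<open>H\<^sub>l b\<^sub>l\<close> has coordinates
  \<open>[l\<^sub>i = 1] v\<^sub>i\<close> (lemma \<open>H_mat_transpose_H_mat\<close>). Averaging over the models replaces the
  indicator by its posterior expectation, the inclusion probability \<open>p\<^sub>i\<close>. With \<open>Q\<close> diagonal the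
  risk therefore separates into coordinates (lemma \<open>predictive_risk_separates\<close>):
  \<open>R(M\<^sub>l) = (\<Sum>i. q\<^sub>i v\<^sub>i\<^sup>2 ([l\<^sub>i = 1] - p\<^sub>i)\<^sup>2)\<close>.
  Each summand is least when \<open>[l\<^sub>i = 1]\<close> is a value of \<open>{0, 1}\<close> nearest to \<open>p\<^sub>i\<close>, with a free
  choice when \<open>p\<^sub>i = 1/2\<close>. So a model that rounds every inclusion probability to a nearest
  integer is at least as good as any other model, provided it is itself under consideration
  (lemma \<open>best_predictive_model_if_rounding\<close>).

  Nestedness supplies this proviso. Variable \<open>i\<close> belongs exactly to the models of size greater than
  \<open>i\<close>, so \<open>p\<^sub>i\<close> is a tail sum of the model probabilities and decreases with \<open>i\<close>; hence the
  variables with \<open>p\<^sub>i \<ge> 1/2\<close> form an initial segment and the median model is one of the nested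
  models. The second description cuts where the distribution function of the model size
  crosses \<open>1/2\<close>. Since \<open>p\<^sub>i\<close> is the complementary tail, that cut is again a rounding, and it
  differs from the first one only in how it treats variables with \<open>p\<^sub>i = 1/2\<close>.\<close>

section \<open>Embedding the coefficients of a submodel\<close>

lemma model_indices_partial_sum_strict_mono:
  assumes "l \<in> model_indices k" "i < i'" "i' < k" "l $ i' = 1"
  shows "(\<Sum>r\<le>i. l $ r) < (\<Sum>r\<le>i'. l $ r)"
proof -
  have "(\<Sum>r\<le>i. l $ r) \<le> (\<Sum>r<i'. l $ r)"
    using assms(2) by (intro sum_mono2) auto
  also have "\<dots> < (\<Sum>r\<le>i'. l $ r)"
    using assms(4) by (simp flip: lessThan_Suc_atMost)
  finally show ?thesis .
qed

text \<open>Each included variable \<open>i\<close> owns one column of \<open>H\<^sub>l\<close>, since the partial sums that number the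
  columns increase strictly along the included variables. Restricting to these coordinates and
  embedding again is therefore the coordinate projection onto the model.\<close>

lemma H_mat_transpose_H_mat:
  fixes v :: "real vec"
  assumes l: "l \<in> model_indices k" and v: "v \<in> carrier_vec k"
  shows "H_mat l *\<^sub>v (transpose_mat (H_mat l) *\<^sub>v v) = vec k (\<lambda>i. of_bool (l $ i = 1) * v $ i)"
proof (rule eq_vecI)
  have dim [simp]: "dim_vec l = k" "dim_vec v = k"
    using l v by (auto simp: model_indices_def)
  define s where "s i = (\<Sum>r\<le>i. l $ r)" for i
  have H_dim: "dim_col (H_mat l) = model_size l"
    by (simp add: H_mat_def)
  show "dim_vec (H_mat l *\<^sub>v (transpose_mat (H_mat l) *\<^sub>v v))
      = dim_vec (vec k (\<lambda>i. of_bool (l $ i = 1) * v $ i))"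
    by (simp add: H_mat_def)
  fix i assume "i < dim_vec (vec k (\<lambda>i. of_bool (l $ i = 1) * v $ i))"
  then have i: "i < k" by simp
  have inj: "i' = i" if "i' < k" "l $ i' = 1" "l $ i = 1" "s i' = s i" for i'
    using model_indices_partial_sum_strict_mono[OF l, of i i']
      model_indices_partial_sum_strict_mono[OF l, of i' i] that i
    by (cases i i' rule: linorder_cases) (auto simp: s_def)
  have restr: "(transpose_mat (H_mat l) *\<^sub>v v) $ c
      = (\<Sum>i'<k. of_bool (l $ i' = 1 \<and> c + 1 = s i') * v $ i')" if "c < model_size l" for c
    using that by (auto simp: H_mat_def s_def scalar_prod_def atLeast0LessThan
        simp del: sum_of_bool_mult_eq intro!: sum.cong)
  have embed: "(H_mat l *\<^sub>v w) $ i
      = (\<Sum>c<model_size l. of_bool (l $ i = 1 \<and> c + 1 = s i) * w $ c)"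
    if "dim_vec w = model_size l" for w :: "real vec"
    using i that by (auto simp: H_mat_def s_def scalar_prod_def atLeast0LessThan
        simp del: sum_of_bool_mult_eq intro!: sum.cong)
  have "(H_mat l *\<^sub>v (transpose_mat (H_mat l) *\<^sub>v v)) $ i
      = (\<Sum>c<model_size l. of_bool (l $ i = 1 \<and> c + 1 = s i) * (transpose_mat (H_mat l) *\<^sub>v v) $ c)"
    using i embed[of "transpose_mat (H_mat l) *\<^sub>v v"] H_dim by simp
  also have "\<dots> = of_bool (l $ i = 1) * v $ i"
  proof (cases "l $ i = 1")
    case True
    have pos: "0 < s i"
      using True member_le_sum[of i "{..i}" "\<lambda>r. l $ r"] by (simp add: s_def)
    have "s i \<le> model_size l"
      unfolding s_def model_size_def using i by (intro sum_mono2) auto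
    then have c: "s i - 1 < model_size l" using pos by linarith
    have "(\<Sum>c<model_size l. of_bool (l $ i = 1 \<and> c + 1 = s i) * (transpose_mat (H_mat l) *\<^sub>v v) $ c)
        = (\<Sum>c<model_size l. if c = s i - 1 then (transpose_mat (H_mat l) *\<^sub>v v) $ c else 0)"
      using True pos by (intro sum.cong) auto
    also have "\<dots> = (transpose_mat (H_mat l) *\<^sub>v v) $ (s i - 1)"
      using c by simp
    also have "\<dots> = (\<Sum>i'<k. of_bool (l $ i' = 1 \<and> s i - 1 + 1 = s i') * v $ i')"
      by (rule restr[OF c])
    also have "\<dots> = (\<Sum>i'<k. if i' = i then v $ i' else 0)"
      using True pos inj by (intro sum.cong) auto
    also have "\<dots> = v $ i" using i by simp
    finally show ?thesis using True by simp
  qed simp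
  finally show "(H_mat l *\<^sub>v (transpose_mat (H_mat l) *\<^sub>v v)) $ i
      = vec k (\<lambda>i. of_bool (l $ i = 1) * v $ i) $ i"
    using i by simp
qed

section \<open>Separation of the risk into coordinates\<close>

lemma averaged_coeffs_eq_inclusion_prob:
  assumes "finite models" "models \<subseteq> model_indices k" "v \<in> carrier_vec k"
    and "\<forall>l\<in>models. b l = transpose_mat (H_mat l) *\<^sub>v v"
  shows "averaged_coeffs k models p b = vec k (\<lambda>i. inclusion_prob models p i * v $ i)"
proof -
  have "(\<Sum>l\<in>models. p l * (H_mat l *\<^sub>v b l) $ i) = inclusion_prob models p i * v $ i"
    if "i < k" for i
  proof -
    have "(\<Sum>l\<in>models. p l * (H_mat l *\<^sub>v b l) $ i)
        = (\<Sum>l\<in>models. (if l $ i = 1 then p l else 0) * v $ i)"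
    proof (rule sum.cong)
      fix l assume "l \<in> models"
      then show "p l * (H_mat l *\<^sub>v b l) $ i = (if l $ i = 1 then p l else 0) * v $ i"
        using assms that H_mat_transpose_H_mat[of l k v] by auto
    qed simp
    also have "\<dots> = inclusion_prob models p i * v $ i"
      using assms(1) by (simp add: inclusion_prob_def sum.inter_filter flip: sum_distrib_right)
    finally show ?thesis .
  qed
  then show ?thesis by (auto simp: averaged_coeffs_def intro!: eq_vecI)
qed

lemma diagonal_quadratic_form:
  fixes Q :: "real mat"
  assumes "Q \<in> carrier_mat k k" "diagonal_mat Q" "d \<in> carrier_vec k"
  shows "d \<bullet> (Q *\<^sub>v d) = (\<Sum>i<k. Q $$ (i, i) * (d $ i)\<^sup>2)"
proof -
  have "(Q *\<^sub>v d) $ i = Q $$ (i, i) * d $ i" if "i < k" for i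
  proof -
    have "(Q *\<^sub>v d) $ i = (\<Sum>j<k. Q $$ (i, j) * d $ j)"
      using assms that by (auto simp: scalar_prod_def atLeast0LessThan)
    also have "\<dots> = (\<Sum>j<k. if j = i then Q $$ (i, j) * d $ j else 0)"
      using assms that by (intro sum.cong) (auto simp: diagonal_mat_def)
    finally show ?thesis using that by simp
  qed
  then show ?thesis
    using assms by (auto simp: scalar_prod_def atLeast0LessThan power2_eq_square intro!: sum.cong)
qed

lemma predictive_risk_separates:
  fixes Q :: "real mat"
  assumes "finite models" "models \<subseteq> model_indices k" "v \<in> carrier_vec k"
    and "\<forall>l\<in>models. b l = transpose_mat (H_mat l) *\<^sub>v v"
    and "Q \<in> carrier_mat k k" "diagonal_mat Q" "l \<in> models"
  shows "predictive_risk k Q models p b l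
    = (\<Sum>i<k. Q $$ (i, i) * (v $ i)\<^sup>2 * (of_bool (l $ i = 1) - inclusion_prob models p i)\<^sup>2)"
proof -
  define d where "d = H_mat l *\<^sub>v b l - averaged_coeffs k models p b"
  have "H_mat l *\<^sub>v b l = vec k (\<lambda>i. of_bool (l $ i = 1) * v $ i)"
    using assms H_mat_transpose_H_mat[of l k v] by auto
  then have d: "d = vec k (\<lambda>i. (of_bool (l $ i = 1) - inclusion_prob models p i) * v $ i)"
    unfolding d_def averaged_coeffs_eq_inclusion_prob[OF assms(1-4)]
    by (auto simp: left_diff_distrib)
  have "predictive_risk k Q models p b l = (\<Sum>i<k. Q $$ (i, i) * (d $ i)\<^sup>2)"
    unfolding predictive_risk_def Let_def d_def[symmetric]
    using assms d by (intro diagonal_quadratic_form) auto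
  then show ?thesis
    by (simp add: d power_mult_distrib mult_ac)
qed

text \<open>Both inequalities are weak, so that at \<open>p\<^sub>i = 1/2\<close> either choice is admitted; this covers
  both descriptions of the median model at once.\<close>

lemma best_predictive_model_if_rounding:
  fixes Q :: "real mat"
  assumes "finite models" "models \<subseteq> model_indices k" "v \<in> carrier_vec k"
    and "\<forall>l\<in>models. b l = transpose_mat (H_mat l) *\<^sub>v v"
    and "Q \<in> carrier_mat k k" "diagonal_mat Q" "\<forall>i<k. 0 \<le> Q $$ (i, i)"
    and "l \<in> models"
    and one: "\<And>i. i < k \<Longrightarrow> l $ i = 1 \<Longrightarrow> 1 / 2 \<le> inclusion_prob models p i"
    and zero: "\<And>i. i < k \<Longrightarrow> l $ i \<noteq> 1 \<Longrightarrow> inclusion_prob models p i \<le> 1 / 2"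
  shows "best_predictive_model k Q models p b l"
proof -
  note risk = predictive_risk_separates[OF assms(1-6)]
  have "predictive_risk k Q models p b l \<le> predictive_risk k Q models p b l'"
    if "l' \<in> models" for l'
    unfolding risk[OF \<open>l \<in> models\<close>] risk[OF that]
  proof (rule sum_mono)
    fix i assume "i \<in> {..<k}"
    then have i: "i < k" by simp
    have "(of_bool (l $ i = 1) - inclusion_prob models p i)\<^sup>2
        \<le> (of_bool (l' $ i = 1) - inclusion_prob models p i)\<^sup>2"
      using one[OF i] zero[OF i]
      by (cases "l $ i = 1"; cases "l' $ i = 1") (auto simp: power2_eq_square algebra_simps)
    then show "Q $$ (i, i) * (v $ i)\<^sup>2 * (of_bool (l $ i = 1) - inclusion_prob models p i)\<^sup>2
        \<le> Q $$ (i, i) * (v $ i)\<^sup>2 * (of_bool (l' $ i = 1) - inclusion_prob models p i)\<^sup>2"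
      using assms(7) i by (intro mult_left_mono) auto
  qed
  then show ?thesis
    using \<open>l \<in> models\<close>
    unfolding best_predictive_model_def is_arg_min_def by (auto simp: not_less)
qed

section \<open>Nested models\<close>

lemma nested_model_in_model_indices: "nested_model k j \<in> model_indices k"
  by (simp add: nested_model_def model_indices_def)

lemma inj_on_nested_model: "inj_on (nested_model k) {0..k}"
proof (rule linorder_inj_onI)
  fix j j' assume "j < j'" "j' \<in> {0..k}"
  then have "nested_model k j $ j \<noteq> nested_model k j' $ j"
    by (simp add: nested_model_def)
  then show "nested_model k j \<noteq> nested_model k j'" by metis
qed auto

lemma inclusion_prob_nested:
  assumes "i < k" and total: "(\<Sum>l\<in>nested_model k ` {0..k}. p l) = 1"
  shows "inclusion_prob (nested_model k ` {0..k}) p i = 1 - (\<Sum>j\<le>i. p (nested_model k j))"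
proof -
  have "{l \<in> nested_model k ` {0..k}. l $ i = 1} = nested_model k ` {i<..k}"
    using assms(1) by (auto simp: nested_model_def split: if_splits)
  then have "inclusion_prob (nested_model k ` {0..k}) p i = (\<Sum>j\<in>{i<..k}. p (nested_model k j))"
    unfolding inclusion_prob_def
    using sum.reindex[OF inj_on_subset[OF inj_on_nested_model[of k]], of "{i<..k}" p] by force
  moreover have "(\<Sum>j\<in>{..i} \<union> {i<..k}. p (nested_model k j))
      = (\<Sum>j\<le>i. p (nested_model k j)) + (\<Sum>j\<in>{i<..k}. p (nested_model k j))"
    by (rule sum.union_disjoint) auto
  moreover have "{..i} \<union> {i<..k} = {0..k}" using assms(1) by auto
  moreover have "(\<Sum>j\<in>{0..k}. p (nested_model k j)) = 1"
    using total by (simp add: sum.reindex[OF inj_on_nested_model])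
  ultimately show ?thesis by simp
qed

text \<open>A set of variables that is closed under passing to smaller indices is an initial segment,
  which is what makes the median model one of the nested models.\<close>

lemma median_model_is_nested:
  assumes antimono: "\<And>i i'. i \<le> i' \<Longrightarrow> i' < k \<Longrightarrow>
      inclusion_prob models p i' \<le> inclusion_prob models p i"
  shows "median_model k models p \<in> nested_model k ` {0..k}"
proof -
  \<comment> \<open>The first excluded variable; the alternative \<open>i = k\<close> makes it exist when all are included.\<close>
  define m where "m = (LEAST i. i = k \<or> inclusion_prob models p i < 1 / 2)"
  have m: "m = k \<or> inclusion_prob models p m < 1 / 2"
    unfolding m_def by (rule LeastI[of _ k]) simp
  have "m \<le> k" unfolding m_def by (rule Least_le) simp
  have "1 / 2 \<le> inclusion_prob models p i \<longleftrightarrow> i < m" if "i < k" for i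
  proof
    assume "i < m"
    then show "1 / 2 \<le> inclusion_prob models p i"
      using not_less_Least[of i "\<lambda>i. i = k \<or> inclusion_prob models p i < 1 / 2"]
      by (simp add: m_def)
  next
    assume "1 / 2 \<le> inclusion_prob models p i"
    then show "i < m"
      using m that antimono[of m i] by (meson leD le_less_trans less_le_trans not_le_imp_less)
  qed
  then have "median_model k models p = nested_model k m"
    by (auto simp: median_model_def nested_model_def intro!: eq_vecI)
  then show ?thesis using \<open>m \<le> k\<close> by simp
qed

lemma ex1_nested_median_size:
  assumes nonneg: "\<And>j. j \<le> k \<Longrightarrow> 0 \<le> p (nested_model k j)"
    and total: "(\<Sum>j\<le>k. p (nested_model k j)) = 1"
  shows "\<exists>!j. nested_median_size k p j"
proof (rule ex_ex1I)
  define F where "F j = (\<Sum>i\<le>j. p (nested_model k i))" for j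
  define j where "j = (LEAST j. 1 / 2 \<le> F j)"
  have k: "1 / 2 \<le> F k" using total by (simp add: F_def)
  have "1 / 2 \<le> F j" unfolding j_def by (rule LeastI[of _ k]) (rule k)
  moreover have "j \<le> k" unfolding j_def by (rule Least_le) (rule k)
  moreover have "(\<Sum>i<j. p (nested_model k i)) < 1 / 2"
  proof (cases j)
    case (Suc j')
    then have "F j' < 1 / 2"
      using not_less_Least[of j' "\<lambda>j. 1 / 2 \<le> F j"] by (simp add: j_def)
    then show ?thesis by (simp add: Suc F_def lessThan_Suc_atMost)
  qed simp
  ultimately show "\<exists>j. nested_median_size k p j"
    unfolding nested_median_size_def F_def by blast
next
  \<comment> \<open>Two different crossings would make the distribution function decrease between them.\<close>
  have "\<not> j < j'" if "nested_median_size k p j" "nested_median_size k p j'" for j j'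
  proof
    assume "j < j'"
    have "(\<Sum>i\<le>j. p (nested_model k i)) \<le> (\<Sum>i<j'. p (nested_model k i))"
      using \<open>j < j'\<close> that(2) nonneg by (intro sum_mono2) (auto simp: nested_median_size_def)
    then show False using that by (auto simp: nested_median_size_def)
  qed
  then show "j = j'" if "nested_median_size k p j" "nested_median_size k p j'" for j j'
    using that by (meson linorder_neqE_nat)
qed

section \<open>The median probability model is the best predictive model\<close>

theorem corollary2:
  fixes S :: "'s measure" and n k :: nat and X :: "real mat" and \<beta> :: "real vec" and \<sigma> :: real
    and \<epsilon> :: "nat \<Rightarrow> 's \<Rightarrow> real" and Y :: "'s \<Rightarrow> real vec" and \<omega> :: 's and y :: "real vec"
    and models :: "nat vec set"
    and p :: "real vec \<Rightarrow> nat vec \<Rightarrow> real"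
    and \<pi> :: "real vec \<Rightarrow> nat vec \<Rightarrow> ((nat \<Rightarrow> real) \<times> real) measure"
    and b :: "nat vec \<Rightarrow> real vec"
    and M :: "'w measure" and x :: "'w \<Rightarrow> real mat" and Q :: "real mat"
  assumes "normal_linear_model S n k X \<beta> \<sigma> \<epsilon> Y"
    and "\<omega> \<in> space S" and "y = Y \<omega>"
    and "posterior_inputs k models (p y) (\<pi> y)"
    and "b = posterior_mean (\<pi> y)"
    and "future_covariates M k x"
    and "Q = second_moment_mat M k x"
    and "positive_definite k Q"
    and "diagonal_mat Q" and "\<forall>i<k. 0 < Q $$ (i, i)"
    and "\<forall>l\<in>models. b l = transpose_mat (H_mat l) *\<^sub>v b (full_model k)"
    and "models = nested_model k ` {0..k}"
  shows "best_predictive_model k Q models (p y) b (median_model k models (p y)) \<and>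
    (\<exists>!j. nested_median_size k (p y) j) \<and>
    (\<forall>j. nested_median_size k (p y) j \<longrightarrow>
       best_predictive_model k Q models (p y) b (nested_model k j))"
proof -
  let ?p = "p y" and ?F = "\<lambda>i. \<Sum>j\<le>i. p y (nested_model k j)"
  define v where "v = b (full_model k)"
  have "finite models" and sub: "models \<subseteq> model_indices k"
    using assms(12) nested_model_in_model_indices by auto
  have v: "v \<in> carrier_vec k"
    using assms(5) by (simp add: v_def posterior_mean_def model_size_def full_model_def)
  have Q: "Q \<in> carrier_mat k k" using assms(8) by (simp add: positive_definite_def)
  have total: "(\<Sum>l\<in>nested_model k ` {0..k}. ?p l) = 1"
    and nonneg: "0 \<le> ?p (nested_model k j)" if "j \<le> k" for j
    using assms(4,12) that by (auto simp: posterior_inputs_def)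
  note total = total[OF le_refl]
  have "?F k = 1"
    using total sum.reindex[OF inj_on_nested_model[of k], of ?p] by (simp add: atLeast0AtMost)
  have incl: "inclusion_prob models ?p i = 1 - ?F i" if "i < k" for i
    unfolding assms(12) using inclusion_prob_nested[OF that total] .
  have F_mono: "?F i \<le> ?F i'" if "i \<le> i'" "i' < k" for i i'
    using that nonneg by (intro sum_mono2) auto
  have best: "best_predictive_model k Q models ?p b l"
    if "l \<in> models" "\<And>i. i < k \<Longrightarrow> l $ i = 1 \<Longrightarrow> 1 / 2 \<le> inclusion_prob models ?p i"
      "\<And>i. i < k \<Longrightarrow> l $ i \<noteq> 1 \<Longrightarrow> inclusion_prob models ?p i \<le> 1 / 2" for l
    using best_predictive_model_if_rounding[OF \<open>finite models\<close> sub v _ Q assms(9) _ that]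
      assms(10,11) by (auto simp: v_def intro: less_imp_le)
  have "best_predictive_model k Q models ?p b (median_model k models ?p)"
  proof (rule best)
    show "median_model k models ?p \<in> models"
      using median_model_is_nested[of k models ?p] incl F_mono assms(12) by auto
  qed (auto simp: median_model_def split: if_splits)
  moreover have "\<exists>!j. nested_median_size k ?p j"
    using ex1_nested_median_size[of k ?p] nonneg \<open>?F k = 1\<close> by blast
  moreover have "best_predictive_model k Q models ?p b (nested_model k j)"
    if j: "nested_median_size k ?p j" for j
  proof (rule best)
    show "nested_model k j \<in> models"
      using j assms(12) by (auto simp: nested_median_size_def)
  next
    fix i assume i: "i < k" "nested_model k j $ i = 1"
    then have "i < j" by (simp add: nested_model_def split: if_splits)
    then have "?F i \<le> (\<Sum>r<j. ?p (nested_model k r))"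
      using j nonneg by (intro sum_mono2) (auto simp: nested_median_size_def)
    then show "1 / 2 \<le> inclusion_prob models ?p i"
      using j i incl by (simp add: nested_median_size_def)
  next
    fix i assume i: "i < k" "nested_model k j $ i \<noteq> 1"
    then have "j \<le> i" by (simp add: nested_model_def split: if_splits)
    then show "inclusion_prob models ?p i \<le> 1 / 2"
      using j i incl F_mono[of j i] by (simp add: nested_median_size_def)
  qed
  ultimately show ?thesis by blast
qed

end
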